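(* Let $K\in\mathbb N$ and let $\mathcal B$ be any bandit algorithm with action set $[K]$. Then, for every integer $\tau\ge 1$ and every $\varepsilon\in(0,1]$, there exists an $\varepsilon$-differentially private bandit algorithm $\mathcal A_\tau$ with action set $[K]$ such that for every $T\in\mathbb N$ $$\operatorname{R}_{\mathcal A_\tau}(T,K)\le \tau\,\tilde{\operatorname{R}}_{\mathcal B}\Bigl(\frac T\tau,K,\frac1{\varepsilon\tau}\Bigr)+\tau .$$ In particular (picking $\tau=\lceil 1/\varepsilon\rceil$), there exists an $\varepsilon$-differentially private bandit algorithm $\mathcal A$ such that for every $T\in\mathbb N$ $$\operatorname{R}_{\mathcal A}(T,K)\le \frac2\varepsilon\,\tilde{\operatorname{R}}_{\mathcal B}(\varepsilon T,K,1)+\frac2\varepsilon .$$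
   Context: $[K]=\{1,\dots,K\}$; $\Pi([K])$ is the set of probability distributions on $[K]$. $\operatorname{Lap}(\lambda)$ is the Laplace distribution with density $\frac1{2\lambda}e^{-|x|/\lambda}$. **Bandit algorithm.** A bandit algorithm with action set $[K]$ is a (measurable) deterministic map $\mathcal A:\bigcup_{t\ge1}([K]\times\mathbb R)^{t-1}\to\Pi([K])$. Run on a fixed sequence of loss functions $\ell_1,\ell_2,\dots$ it proceeds in rounds: in round $t$, given the history $\mathcal H_t=(I_s,\ell_s(I_s))_{s=1}^{t-1}$ of its past actions and observed losses, it samples $I_t\sim\mathcal A(\mathcal H_t)$ and then observes only $\ell_t(I_t)$. A procedure that also keeps internal random state is identified with the bandit algorithm given by its conditional law of $I_t$ given $\mathcal H_t$. **Regret.** $\operatorname{R}_{\mathcal A}(T,K)=\sup_{\ell_{1:T}}\bigl(\mathbb E[\sum_{t=1}^T\ell_t(I_t)]-\inf_{i\in[K]}\sum_{t=1}^T\ell_t(i)\bigr)$, the supremum being over all sequences of functions $\ell_t:[K]\to[0,1]$ fixed in advance. **Regret under noisy observations.** For $\lambda>0$, $\tilde{\operatorname{R}}_{\mathcal B}(T,K,\lambda)=\sup_{\ell_{1:T}}\bigl(\mathbb E[\sum_{t=1}^T\ell_t(I_t)]-\inf_{i\in[K]}\sum_{t=1}^T\ell_t(i)\bigr)$, where again $\ell_t:[K]\to[0,1]$, but $I_1,\dots,I_T$ are the actions of $\mathcal B$ when run on the noisy losses $\tilde\ell_t(i)=\ell_t(i)+Z_t(i)$, with $Z_t(i)\sim\operatorname{Lap}(\lambda)$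 independent over all $t,i$; i.e. $I_t\sim\mathcal B((I_s,\tilde\ell_s(I_s))_{s<t})$. The expectation is over $\mathcal B$'s randomness and the noise. For non-integer $x\ge0$, $\tilde{\operatorname{R}}_{\mathcal B}(x,K,\lambda)$ means $\tilde{\operatorname{R}}_{\mathcal B}(\lfloor x\rfloor,K,\lambda)$, and it is $0$ when $\lfloor x\rfloor=0$. **Differential privacy.** $\mathcal A$ is $(\varepsilon,\delta)$-differentially private if for every $T\in\mathbb N$, any two sequences $\ell_{1:T},\ell'_{1:T}$ of functions $[K]\to[0,1]$ differing at exactly one time point, and any $E\subset[K]^T$, $\mathbb P[(I_1,\dots,I_T)\in E]\le e^\varepsilon\,\mathbb P[(I'_1,\dots,I'_T)\in E]+\delta$, where $I_{1:T}$ and $I'_{1:T}$ are the actions played by $\mathcal A$ on $\ell_{1:T}$ and $\ell'_{1:T}$. $\varepsilon$-differentially private means $(\varepsilon,0)$-differentially private. *)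

theory Defs
  imports "HOL-Probability.Probability"
begin

text \<open>Rounds are numbered \<open>0, 1, 2, \<dots>\<close>, so a horizon \<open>T\<close> comprises the rounds in \<open>{..<T}\<close>; actions are
  \<open>{1..K}\<close>. A history is the list of pairs (action, observed loss) in chronological order.\<close>

type_synonym bandit = "(nat \<times> real) list \<Rightarrow> nat pmf"

type_synonym losses = "nat \<Rightarrow> nat \<Rightarrow> real"

text \<open>Histories of length \<open>n\<close> carry the product sigma-algebra, transported from functions on \<open>{..<n}\<close> to
  lists by \<open>map h [0..<n]\<close>; distributions on the finite set \<open>{1..K}\<close> carry the Borel structure of the
  simplex, which is generated by the point probabilities. Values of \<open>A\<close> on lists containing
  actions outside \<open>{1..K}\<close> are irrelevant. There is no such \<open>A\<close> when \<open>K = 0\<close>.\<close>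

definition bandit_algorithm :: "nat \<Rightarrow> bandit \<Rightarrow> bool" where
  "bandit_algorithm K A \<longleftrightarrow>
     (\<forall>h. fst ` set h \<subseteq> {1..K} \<longrightarrow> set_pmf (A h) \<subseteq> {1..K}) \<and>
     (\<forall>n. \<forall>i\<in>{1..K}. (\<lambda>h. pmf (A (map h [0..<n])) i)
        \<in> borel_measurable (\<Pi>\<^sub>M s\<in>{..<n}. count_space {1..K} \<Otimes>\<^sub>M (borel :: real measure)))"

definition history :: "losses \<Rightarrow> nat list \<Rightarrow> (nat \<times> real) list" where
  "history f xs = map (\<lambda>s. (xs ! s, f s (xs ! s))) [0..<length xs]"

text \<open>Law of the first \<open>T\<close> actions on a fixed loss sequence. The losses are arbitrary reals, so that
  realisations of noisy losses are covered as well.\<close>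

primrec actions :: "bandit \<Rightarrow> losses \<Rightarrow> nat \<Rightarrow> nat list pmf" where
  "actions A f 0 = return_pmf []"
| "actions A f (Suc t) =
     bind_pmf (actions A f t) (\<lambda>xs. map_pmf (\<lambda>i. xs @ [i]) (A (history f xs)))"

definition loss_seqs :: "nat \<Rightarrow> nat \<Rightarrow> losses set" where
  "loss_seqs K T = {l. \<forall>t<T. \<forall>i\<in>{1..K}. 0 \<le> l t i \<and> l t i \<le> 1}"

text \<open>In \<open>expected_loss A f l T\<close> the algorithm runs on the losses \<open>f\<close> but is charged the losses \<open>l\<close>.\<close>

definition expected_loss :: "bandit \<Rightarrow> losses \<Rightarrow> losses \<Rightarrow> nat \<Rightarrow> real" where
  "expected_loss A f l T = measure_pmf.expectation (actions A f T) (\<lambda>xs. \<Sum>t<T. l t (xs ! t))"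

definition best_loss :: "losses \<Rightarrow> nat \<Rightarrow> nat \<Rightarrow> real" where
  "best_loss l T K = (INF i\<in>{1..K}. \<Sum>t<T. l t i)"

text \<open>For a bandit algorithm all regrets below lie in \<open>{-T..T}\<close>, so the real-valued suprema are taken over
  nonempty bounded sets.\<close>

definition regret :: "bandit \<Rightarrow> nat \<Rightarrow> nat \<Rightarrow> real" where
  "regret A T K = (SUP l\<in>loss_seqs K T. expected_loss A l l T - best_loss l T K)"

definition laplace :: "real \<Rightarrow> real measure" where
  "laplace lam = density lborel (\<lambda>x. ennreal (1 / (2 * lam) * exp (- \<bar>x\<bar> / lam)))"

definition noise :: "nat \<Rightarrow> nat \<Rightarrow> real \<Rightarrow> (nat \<times> nat \<Rightarrow> real) measure" where
  "noise T K lam = (\<Pi>\<^sub>M p\<in>{..<T} \<times> {1..K}. laplace lam)"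

definition noisy_regret_nat :: "bandit \<Rightarrow> nat \<Rightarrow> nat \<Rightarrow> real \<Rightarrow> real" where
  "noisy_regret_nat B T K lam = (SUP l\<in>loss_seqs K T.
     (\<integral>Z. expected_loss B (\<lambda>t i. l t i + Z (t, i)) l T \<partial>noise T K lam) - best_loss l T K)"

definition noisy_regret :: "bandit \<Rightarrow> real \<Rightarrow> nat \<Rightarrow> real \<Rightarrow> real" where
  "noisy_regret B x K lam = noisy_regret_nat B (nat \<lfloor>x\<rfloor>) K lam"

lemma noisy_regret_eq_0:
  assumes "K \<ge> 1" and "nat \<lfloor>x\<rfloor> = 0"
  shows "noisy_regret B x K lam = 0"
  using assms
  by (simp add: noisy_regret_def noisy_regret_nat_def loss_seqs_def expected_loss_def best_loss_def)

definition differentially_private :: "nat \<Rightarrow> real \<Rightarrow> real \<Rightarrow> bandit \<Rightarrow> bool" where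
  "differentially_private K eps delta A \<longleftrightarrow>
     (\<forall>T. \<forall>l\<in>loss_seqs K T. \<forall>l'\<in>loss_seqs K T.
        (\<exists>!t. t < T \<and> (\<exists>i\<in>{1..K}. l t i \<noteq> l' t i)) \<longrightarrow>
        (\<forall>E \<subseteq> {xs. length xs = T \<and> set xs \<subseteq> {1..K}}.
           measure_pmf.prob (actions A l T) E
             \<le> exp eps * measure_pmf.prob (actions A l' T) E + delta))"

end

theory Submission
  imports Defs
begin

text \<open>Divide time into blocks of length \<open>\<tau>\<close>, play one action per block and report to \<open>B\<close> the
  average loss of the block plus Laplace noise. Changing a single loss moves one average by at most
  \<open>1 / \<tau>\<close>, so noise of scale \<open>lam\<close> gives \<open>1 / (\<tau> * lam)\<close>-differential privacy, and the regret over complete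
  blocks is \<open>\<tau>\<close> times the noisy regret of \<open>B\<close> on the averaged losses. The noise is internal randomness;
  integrating it out, the probability that the blocks play \<open>J\<close> when the averages are \<open>a\<close> is
  \<open>smoothed B lam J a\<close>, and the conditional law of the next action is a quotient of two such
  probabilities. For the second claim, noise of scale 1 already suffices for \<open>\<tau> = \<lceil>1 / \<epsilon>\<rceil>\<close>, so that the
  noise level need not be compared, and the noisy regret is monotone in the horizon.\<close>

section \<open>The Laplace distribution\<close>

lemma space_laplace [simp]: "space (laplace lam) = UNIV"
  and sets_laplace [measurable_cong, simp]: "sets (laplace lam) = sets borel"
  by (simp_all add: laplace_def)

text \<open>Away from 0 the density is half the exponential density of rate \<open>1 / lam\<close>
  plus half its reflection, and each of these has total mass 1.\<close>

lemma prob_space_laplace: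
  assumes "lam > 0"
  shows "prob_space (laplace lam)"
proof
  let ?e = "exponential_density (1 / lam)"
  have e1: "(\<integral>\<^sup>+x. ennreal (?e x) \<partial>lborel) = 1"
    using prob_space.emeasure_space_1[OF prob_space_exponential_density[of "1 / lam"]] assms
    by (simp add: emeasure_density)
  have e2: "(\<integral>\<^sup>+x. ennreal (?e (- x)) \<partial>lborel) = 1"
    using nn_integral_real_affine[of "\<lambda>x. ennreal (?e x)" "-1" 0] e1 by simp
  have "emeasure (laplace lam) (space (laplace lam))
      = (\<integral>\<^sup>+x. ennreal (1 / (2 * lam) * exp (- \<bar>x\<bar> / lam)) \<partial>lborel)"
    by (simp add: laplace_def emeasure_density)
  also have "\<dots> = (\<integral>\<^sup>+x. ennreal (1 / 2) * (ennreal (?e x) + ennreal (?e (- x))) \<partial>lborel)"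
  \<comment> \<open>At 0 both one-sided densities are positive, so the identity fails there; a
    single point is a null set.\<close>
  proof (intro nn_integral_cong_AE eventually_mono[OF AE_lborel_singleton[of 0]])
    fix x :: real assume "x \<noteq> 0"
    then have "1 / (2 * lam) * exp (- \<bar>x\<bar> / lam) = 1 / 2 * (?e x + ?e (- x))"
      by (simp add: exponential_density_def)
    then show "ennreal (1 / (2 * lam) * exp (- \<bar>x\<bar> / lam)) = ennreal (1 / 2) * (ennreal (?e x) + ennreal (?e (- x)))"
      using assms by (simp only: ennreal_mult' ennreal_plus exponential_density_nonneg divide_nonneg_nonneg
          zero_le_one zero_le_numeral order_less_imp_le zero_less_divide_1_iff)
  qed
  also have "\<dots> = ennreal (1 / 2) * (1 + 1)"
    by (subst nn_integral_cmult, simp, subst nn_integral_add) (simp_all only: e1 e2, simp_all)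
  also have "\<dots> = ennreal (1 / 2 * (1 + 1))"
    by (simp only: ennreal_mult' ennreal_plus ennreal_1 zero_le_one divide_nonneg_nonneg zero_le_numeral)
  also have "\<dots> = 1" by simp
  finally show "emeasure (laplace lam) (space (laplace lam)) = 1" .
qed

text \<open>The source of all privacy below. The substitution \<open>y = c + z\<close> moves the
  shift from the integrand to the density, and by the triangle inequality the densities centred at
  \<open>a\<close> and \<open>b\<close> differ pointwise by at most the stated factor.\<close>

lemma nn_integral_laplace_shift_le:
  fixes g :: "real \<Rightarrow> ennreal"
  assumes [measurable]: "g \<in> borel_measurable borel" and lam: "lam > 0"
  shows "(\<integral>\<^sup>+z. g (a + z) \<partial>laplace lam)
    \<le> ennreal (exp (\<bar>a - b\<bar> / lam)) * (\<integral>\<^sup>+z. g (b + z) \<partial>laplace lam)"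
proof -
  let ?d = "\<lambda>x. ennreal (1 / (2 * lam) * exp (- \<bar>x\<bar> / lam))"
  have shift: "(\<integral>\<^sup>+z. g (c + z) \<partial>laplace lam) = (\<integral>\<^sup>+y. ?d (y - c) * g y \<partial>lborel)" for c
    using nn_integral_real_affine[of "\<lambda>y. ?d (y - c) * g y" 1 c]
    by (simp add: laplace_def nn_integral_density)
  have "?d (y - a) \<le> ennreal (exp (\<bar>a - b\<bar> / lam)) * ?d (y - b)" for y
  proof -
    have "- \<bar>y - a\<bar> / lam \<le> \<bar>a - b\<bar> / lam + - \<bar>y - b\<bar> / lam"
      using lam by (simp add: field_simps)
    then have "exp (- \<bar>y - a\<bar> / lam) \<le> exp (\<bar>a - b\<bar> / lam) * exp (- \<bar>y - b\<bar> / lam)"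
      by (simp add: exp_add[symmetric])
    then show ?thesis
      using lam by (simp add: ennreal_mult[symmetric] field_simps)
  qed
  then have "?d (y - a) * g y \<le> ennreal (exp (\<bar>a - b\<bar> / lam)) * (?d (y - b) * g y)" for y
    by (metis mult.assoc mult_right_mono zero_le)
  then show ?thesis
    unfolding shift by (subst nn_integral_cmult[symmetric]) (auto intro!: nn_integral_mono)
qed

section \<open>Laws of action sequences\<close>

definition action_lists :: "nat \<Rightarrow> nat \<Rightarrow> nat list set" where
  "action_lists K n = {xs. length xs = n \<and> set xs \<subseteq> {1..K}}"

lemma finite_action_lists [simp]: "finite (action_lists K n)"
  unfolding action_lists_def using finite_lists_length_eq[of "{1..K}" n] by (simp add: conj_commute)

lemma action_listsD: "xs \<in> action_lists K n \<Longrightarrow> length xs = n"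
    "xs \<in> action_lists K n \<Longrightarrow> t < n \<Longrightarrow> xs ! t \<in> {1..K}"
  unfolding action_lists_def by (auto simp: subset_iff)

lemma action_lists_snoc_iff:
  "xs @ [i] \<in> action_lists K (Suc n) \<longleftrightarrow> xs \<in> action_lists K n \<and> i \<in> {1..K}"
  by (auto simp: action_lists_def)

lemma fst_history: "set xs \<subseteq> S \<Longrightarrow> fst ` set (history f xs) \<subseteq> S"
  by (force simp: history_def set_conv_nth)

lemma set_pmf_actions:
  assumes "bandit_algorithm K A"
  shows "set_pmf (actions A f n) \<subseteq> action_lists K n"
proof (induction n)
  case (Suc n)
  show ?case
  proof
    fix ys assume "ys \<in> set_pmf (actions A f (Suc n))"
    then obtain xs i where xs: "xs \<in> set_pmf (actions A f n)" "i \<in> set_pmf (A (history f xs))"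
        "ys = xs @ [i]" by auto
    have "xs \<in> action_lists K n" using xs Suc by blast
    moreover from this have "set_pmf (A (history f xs)) \<subseteq> {1..K}"
      using assms fst_history[of xs "{1..K}" f] by (simp add: bandit_algorithm_def action_lists_def)
    ultimately show "ys \<in> action_lists K (Suc n)"
      using xs action_lists_snoc_iff by blast
  qed
qed (simp add: action_lists_def)

lemma length_actions: "xs \<in> set_pmf (actions A f n) \<Longrightarrow> length xs = n"
  by (induction n arbitrary: xs) auto

lemma pmf_actions_snoc:
  "pmf (actions A f (Suc n)) (xs @ [i]) = pmf (actions A f n) xs * pmf (A (history f xs)) i"
proof -
  have "pmf (actions A f (Suc n)) (xs @ [i])
      = (\<integral>ys. indicator {xs} ys * pmf (A (history f xs)) i \<partial>measure_pmf (actions A f n))"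
    unfolding actions.simps pmf_bind
  proof (intro Bochner_Integration.integral_cong refl)
    fix ys
    have "(\<lambda>j. ys @ [j]) -` {xs @ [i]} = (if ys = xs then {i} else {})" by auto
    then show "pmf (map_pmf (\<lambda>i. ys @ [i]) (A (history f ys))) (xs @ [i])
        = indicator {xs} ys * pmf (A (history f xs)) i"
      by (simp add: pmf_map measure_pmf_single)
  qed
  then show ?thesis by (simp add: measure_pmf_single)
qed

lemma expectation_actions:
  fixes g :: "nat list \<Rightarrow> real"
  assumes "bandit_algorithm K A"
  shows "measure_pmf.expectation (actions A f n) g = (\<Sum>xs\<in>action_lists K n. g xs * pmf (actions A f n) xs)"
  using set_pmf_actions[OF assms, of f n] by (intro integral_measure_pmf_real) auto

lemma sum_pmf_actions:
  assumes "bandit_algorithm K A"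
  shows "(\<Sum>xs\<in>action_lists K n. pmf (actions A f n) xs) = 1"
  using sum_pmf_eq_1[OF finite_action_lists set_pmf_actions[OF assms]] .

text \<open>Later rounds do not influence earlier ones. This serves twice: to cut off an incomplete
  final block, and to compare the noisy regret of \<open>B\<close> at two horizons.\<close>

lemma map_take_actions: "n \<le> m \<Longrightarrow> map_pmf (take n) (actions A f m) = actions A f n"
proof (induction m rule: dec_induct)
  case base
  have "map_pmf (take n) (actions A f n) = map_pmf (\<lambda>x. x) (actions A f n)"
    by (intro map_pmf_cong) (auto simp: length_actions)
  then show ?case by simp
next
  case (step m)
  have "map_pmf (take n) (actions A f (Suc m))
      = bind_pmf (actions A f m) (\<lambda>xs. map_pmf (\<lambda>_. take n xs) (A (history f xs)))"
    unfolding actions.simps map_bind_pmf map_pmf_comp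
    using step by (intro bind_pmf_cong refl map_pmf_cong) (auto simp: length_actions)
  also have "\<dots> = map_pmf (take n) (actions A f m)"
    by (simp add: map_pmf_const map_pmf_def[of "take n"])
  finally show ?case using step by simp
qed

section \<open>Probability of a fixed path as a function of the observed values\<close>

definition path_prob :: "bandit \<Rightarrow> nat list \<Rightarrow> (nat \<Rightarrow> real) \<Rightarrow> real" where
  "path_prob B J y = (\<Prod>c<length J. pmf (B (map (\<lambda>s. (J ! s, y s)) [0..<c])) (J ! c))"

lemma path_prob_snoc:
  "path_prob B (J @ [j]) y = path_prob B J y * pmf (B (map (\<lambda>s. (J ! s, y s)) [0..<length J])) j"
proof -
  have *: "map (\<lambda>s. ((J @ [j]) ! s, y s)) [0..<c] = map (\<lambda>s. (J ! s, y s)) [0..<c]"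
    if "c \<le> length J" for c
    using that by (auto simp: nth_append)
  show ?thesis
    unfolding path_prob_def by (simp add: * del: map_eq_conv) (simp add: nth_append)
qed

text \<open>The factor of round \<open>c\<close> reads only the observations made before
  \<open>c\<close>, and \<open>c\<close> is at most \<open>length J - 1\<close>; hence the
  observation of the last round is never read.\<close>

lemma path_prob_cong:
  assumes "\<And>s. Suc s < length J \<Longrightarrow> y s = y' s"
  shows "path_prob B J y = path_prob B J y'"
  unfolding path_prob_def
proof (intro prod.cong refl)
  fix c assume "c \<in> {..<length J}"
  then have "map (\<lambda>s. (J ! s, y s)) [0..<c] = map (\<lambda>s. (J ! s, y' s)) [0..<c]"
    using assms by auto
  then show "pmf (B (map (\<lambda>s. (J ! s, y s)) [0..<c])) (J ! c)
      = pmf (B (map (\<lambda>s. (J ! s, y' s)) [0..<c])) (J ! c)" by (simp only:)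
qed

lemma path_prob_nonneg [simp]: "0 \<le> path_prob B J y"
  unfolding path_prob_def by (intro prod_nonneg) auto

lemma path_prob_le_1 [simp]: "path_prob B J y \<le> 1"
  unfolding path_prob_def by (intro prod_le_1) (auto simp: pmf_le_1)

lemma pmf_actions_eq_path_prob:
  "length J = n \<Longrightarrow> pmf (actions B f n) J = path_prob B J (\<lambda>s. f s (J ! s))"
proof (induction J arbitrary: n rule: rev_induct)
  case Nil
  then show ?case by (simp add: path_prob_def)
next
  case (snoc j J)
  then obtain m where n: "n = Suc m" "length J = m" by auto
  have "path_prob B (J @ [j]) (\<lambda>s. f s ((J @ [j]) ! s)) = path_prob B (J @ [j]) (\<lambda>s. f s (J ! s))"
    by (intro path_prob_cong) (auto simp: nth_append)
  then show ?case
    using snoc.IH[OF n(2)] n by (simp add: pmf_actions_snoc path_prob_snoc history_def del: actions.simps)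
qed

lemma measurable_path_prob:
  assumes B: "bandit_algorithm K B" and J: "set J \<subseteq> {1..K}"
    and y: "\<And>s. Suc s < length J \<Longrightarrow> (\<lambda>x. y x s) \<in> borel_measurable M"
  shows "(\<lambda>x. path_prob B J (y x)) \<in> borel_measurable M"
  unfolding path_prob_def
proof (intro borel_measurable_prod)
  fix c assume c: "c \<in> {..<length J}"
  have Js: "J ! s \<in> {1..K}" if "s < length J" for s using J that nth_mem by blast
  \<comment> \<open>Since \<open>J\<close> is fixed, the history is a measurable map into the
    product space in the definition of \<open>bandit_algorithm\<close>; the restriction makes it
    extensional, as elements of that space must be.\<close>
  let ?h = "\<lambda>x. \<lambda>s\<in>{..<c}. (J ! s, y x s)"
  have "?h \<in> measurable M (\<Pi>\<^sub>M s\<in>{..<c}. count_space {1..K} \<Otimes>\<^sub>M borel)"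
    using c Js by (intro measurable_restrict measurable_Pair y) auto
  from measurable_compose[OF this, of "\<lambda>h. pmf (B (map h [0..<c])) (J ! c)"]
  have "(\<lambda>x. pmf (B (map (?h x) [0..<c])) (J ! c)) \<in> borel_measurable M"
    using B c Js unfolding bandit_algorithm_def by blast
  moreover have "map (?h x) [0..<c] = map (\<lambda>s. (J ! s, y x s)) [0..<c]" for x by auto
  ultimately show "(\<lambda>x. pmf (B (map (\<lambda>s. (J ! s, y x s)) [0..<c])) (J ! c)) \<in> borel_measurable M"
    by simp
qed

section \<open>Integrating out the noise\<close>

text \<open>An infinite product, so that paths of different lengths, in particular \<open>J\<close>
  and \<open>J @ [j]\<close>, are integrated over one and the same space.\<close>

abbreviation laplace_seq :: "real \<Rightarrow> (nat \<Rightarrow> real) measure" where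
  "laplace_seq lam \<equiv> \<Pi>\<^sub>M s\<in>UNIV. laplace lam"

lemma prob_space_laplace_seq: "lam > 0 \<Longrightarrow> prob_space (laplace_seq lam)"
  by (intro prob_space_PiM prob_space_laplace)

text \<open>Along a fixed path only one noise value per round is seen, so the noise is indexed by
  rounds alone. The link with noise indexed by rounds and actions is
  \<open>integral_noise_path_prob\<close>.\<close>

definition smoothed :: "bandit \<Rightarrow> real \<Rightarrow> nat list \<Rightarrow> (nat \<Rightarrow> real) \<Rightarrow> real" where
  "smoothed B lam J a = (\<integral>Z. path_prob B J (\<lambda>s. a s + Z s) \<partial>laplace_seq lam)"

lemma smoothed_cong:
  assumes "\<And>s. Suc s < length J \<Longrightarrow> a s = a' s"
  shows "smoothed B lam J a = smoothed B lam J a'"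
  unfolding smoothed_def using assms
  by (intro Bochner_Integration.integral_cong refl path_prob_cong) auto

lemma smoothed_nonneg [simp]: "0 \<le> smoothed B lam J a"
  unfolding smoothed_def by (intro integral_nonneg_AE) auto

lemma measurable_path_prob_shift:
  assumes "bandit_algorithm K B" "set J \<subseteq> {1..K}"
  shows "(\<lambda>Z. path_prob B J (\<lambda>s. a s + Z s)) \<in> borel_measurable (laplace_seq lam)"
proof (rule measurable_path_prob[OF assms])
  have "(\<lambda>Z. Z s) \<in> borel_measurable (laplace_seq lam)" for s
    using measurable_component_singleton[of s UNIV "\<lambda>_. laplace lam"] by (simp cong: measurable_cong_sets)
  then show "(\<lambda>Z. a s + Z s) \<in> borel_measurable (laplace_seq lam)" for s by simp
qed

lemma integrable_path_prob_shift:
  assumes "bandit_algorithm K B" "set J \<subseteq> {1..K}" "lam > 0"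
  shows "integrable (laplace_seq lam) (\<lambda>Z. path_prob B J (\<lambda>s. a s + Z s))"
  using measurable_path_prob_shift[OF assms(1,2)] prob_space_laplace_seq[OF assms(3)]
  by (intro finite_measure.integrable_const_bound[where B = 1]) (auto simp: prob_space_def)

text \<open>The averages fed to \<open>smoothed\<close> will depend on the history, and the
  resulting algorithm must be measurable in it; this is measurability of an integral in its
  parameter.\<close>

lemma measurable_smoothed:
  assumes B: "bandit_algorithm K B" and J: "set J \<subseteq> {1..K}" and lam: "lam > 0"
    and a: "\<And>s. Suc s < length J \<Longrightarrow> (\<lambda>x. a x s) \<in> borel_measurable M"
  shows "(\<lambda>x. smoothed B lam J (a x)) \<in> borel_measurable M"
proof -
  interpret prob_space "laplace_seq lam" by (rule prob_space_laplace_seq[OF lam])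
  show ?thesis
    unfolding smoothed_def
  proof (intro borel_measurable_lebesgue_integral)
    have *: "(\<lambda>p. snd p s) \<in> borel_measurable (M \<Otimes>\<^sub>M laplace_seq lam)" for s
      using measurable_compose[OF measurable_snd measurable_component_singleton[of s UNIV "\<lambda>_. laplace lam"]]
      by (simp cong: measurable_cong_sets)
    show "(\<lambda>(x, Z). path_prob B J (\<lambda>s. a x s + Z s)) \<in> borel_measurable (M \<Otimes>\<^sub>M laplace_seq lam)"
      unfolding split_beta
      using measurable_compose[OF measurable_fst a] *
      by (intro measurable_path_prob[OF B J] borel_measurable_add) 
  qed
qed

lemma smoothed_Nil [simp]: "lam > 0 \<Longrightarrow> smoothed B lam [] a = 1"
  using prob_space.prob_space[OF prob_space_laplace_seq] by (simp add: smoothed_def path_prob_def)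

text \<open>For every realisation of the noise the law of the next action under \<open>B\<close> has
  mass 1 on the actions. This makes the quotients in \<open>conditional_law\<close> a probability
  distribution.\<close>

lemma sum_smoothed_snoc:
  assumes B: "bandit_algorithm K B" and J: "set J \<subseteq> {1..K}" and lam: "lam > 0"
  shows "(\<Sum>j\<in>{1..K}. smoothed B lam (J @ [j]) a) = smoothed B lam J a"
proof -
  have "(\<Sum>j\<in>{1..K}. smoothed B lam (J @ [j]) a)
      = (\<integral>Z. (\<Sum>j\<in>{1..K}. path_prob B (J @ [j]) (\<lambda>s. a s + Z s)) \<partial>laplace_seq lam)"
    unfolding smoothed_def using J
    by (intro Bochner_Integration.integral_sum[symmetric] integrable_path_prob_shift[OF B _ lam]) auto
  also have "\<dots> = smoothed B lam J a"
    unfolding smoothed_def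
  proof (intro Bochner_Integration.integral_cong refl)
    fix Z
    let ?h = "map (\<lambda>s. (J ! s, a s + Z s)) [0..<length J]"
    have "fst ` set ?h \<subseteq> {1..K}" using J by (force simp: set_conv_nth)
    then have "(\<Sum>j\<in>{1..K}. pmf (B ?h) j) = 1"
      using B unfolding bandit_algorithm_def by (intro sum_pmf_eq_1) auto
    then show "(\<Sum>j\<in>{1..K}. path_prob B (J @ [j]) (\<lambda>s. a s + Z s)) = path_prob B J (\<lambda>s. a s + Z s)"
      unfolding path_prob_snoc sum_distrib_left[symmetric] by simp
  qed
  finally show ?thesis .
qed

text \<open>By Fubini the noise in coordinate \<open>c\<close> is integrated first, with all other
  coordinates frozen; there the shift bound for a single Laplace variable applies.\<close>

lemma smoothed_le:
  assumes B: "bandit_algorithm K B" and J: "set J \<subseteq> {1..K}" and lam: "lam > 0"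
    and a: "\<And>s. s \<noteq> c \<Longrightarrow> a s = a' s"
  shows "smoothed B lam J a \<le> exp (\<bar>a c - a' c\<bar> / lam) * smoothed B lam J a'"
proof -
  interpret S: prob_space "laplace_seq lam" by (rule prob_space_laplace_seq[OF lam])
  interpret L: prob_space "laplace lam" by (rule prob_space_laplace[OF lam])
  interpret LS: pair_sigma_finite "laplace lam" "laplace_seq lam" ..
  \<comment> \<open>Replacing coordinate \<open>c\<close> by an independent Laplace draw preserves
    the law of the sequence, which isolates that coordinate.\<close>
  have dist: "distr (laplace lam \<Otimes>\<^sub>M laplace_seq lam) (laplace_seq lam) (\<lambda>(z, Z). Z(c := z)) = laplace_seq lam"
    using distr_pair_PiM_eq_PiM[of UNIV "\<lambda>_. laplace lam" c] prob_space_laplace[OF lam] by simp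
  have upd: "(\<lambda>(z, Z). Z(c := z)) \<in> laplace lam \<Otimes>\<^sub>M laplace_seq lam \<rightarrow>\<^sub>M laplace_seq lam"
    using measurable_add_dim[of c UNIV "\<lambda>_. laplace lam"]
    by (subst measurable_pair_swap_iff) (simp add: split_beta')
  \<comment> \<open>The argument \<open>y\<close> is the whole noisy value observed in round
    \<open>c\<close>. So \<open>?g\<close> no longer depends on \<open>a c\<close>, and
    \<open>a\<close> and \<open>a'\<close> give the same function.\<close>
  let ?g = "\<lambda>a Z y. ennreal (path_prob B J ((\<lambda>s. a s + Z s)(c := y)))"
  have nn: "ennreal (smoothed B lam J b)
      = (\<integral>\<^sup>+Z. (\<integral>\<^sup>+z. ?g b Z (b c + z) \<partial>laplace lam) \<partial>laplace_seq lam)" for b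
  proof -
    note meas = measurable_path_prob_shift[OF B J, of b lam]
    have "ennreal (smoothed B lam J b) = (\<integral>\<^sup>+Z. path_prob B J (\<lambda>s. b s + Z s) \<partial>laplace_seq lam)"
      unfolding smoothed_def
      by (intro nn_integral_eq_integral[symmetric] integrable_path_prob_shift[OF B J lam]) auto
    also have "\<dots> = (\<integral>\<^sup>+p. path_prob B J (\<lambda>s. b s + ((snd p)(c := fst p)) s) \<partial>(laplace lam \<Otimes>\<^sub>M laplace_seq lam))"
      using meas upd
      by (subst dist[symmetric], subst nn_integral_distr) (auto simp: split_beta')
    also have "\<dots> = (\<integral>\<^sup>+Z. (\<integral>\<^sup>+z. path_prob B J (\<lambda>s. b s + (Z(c := z)) s) \<partial>laplace lam) \<partial>laplace_seq lam)"
      using measurable_compose[OF upd meas]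
      by (subst LS.nn_integral_snd[symmetric]) (auto simp: split_beta')
    also have "\<dots> = (\<integral>\<^sup>+Z. (\<integral>\<^sup>+z. ?g b Z (b c + z) \<partial>laplace lam) \<partial>laplace_seq lam)"
      by (intro nn_integral_cong arg_cong[where f = ennreal] path_prob_cong) auto
    finally show ?thesis .
  qed
  have g: "?g a Z y = ?g a' Z y" for Z y
    using a by (intro arg_cong[where f = ennreal] path_prob_cong) auto
  have gm: "?g a' Z \<in> borel_measurable borel" for Z
    by (intro measurable_compose[OF measurable_path_prob[OF B J] measurable_ennreal]) auto
  let ?e = "ennreal (exp (\<bar>a c - a' c\<bar> / lam))"
  have "ennreal (smoothed B lam J a)
      \<le> (\<integral>\<^sup>+Z. ?e * (\<integral>\<^sup>+z. ?g a' Z (a' c + z) \<partial>laplace lam) \<partial>laplace_seq lam)"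
    unfolding nn[of a] g by (intro nn_integral_mono nn_integral_laplace_shift_le gm lam)
  also have "\<dots> = ?e * ennreal (smoothed B lam J a')"
    unfolding nn
  proof (intro nn_integral_cmult L.borel_measurable_nn_integral)
    show "(\<lambda>(Z, z). ?g a' Z (a' c + z)) \<in> borel_measurable (laplace_seq lam \<Otimes>\<^sub>M laplace lam)"
      unfolding split_beta'
    proof (intro measurable_compose[OF measurable_path_prob[OF B J] measurable_ennreal])
      fix s
      have [measurable]: "(\<lambda>p. fst p s) \<in> borel_measurable (laplace_seq lam \<Otimes>\<^sub>M laplace lam)"
        using measurable_compose[OF measurable_fst measurable_component_singleton[of s UNIV "\<lambda>_. laplace lam"]]
        by (simp cong: measurable_cong_sets)
      show "(\<lambda>p. ((\<lambda>s. a' s + fst p s)(c := a' c + snd p)) s)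
          \<in> borel_measurable (laplace_seq lam \<Otimes>\<^sub>M laplace lam)"
        by (cases "s = c") auto
    qed
  qed
  finally show ?thesis
    by (simp add: ennreal_mult[symmetric])
qed

text \<open>The path meets the noise only in the cells \<open>(s, J ! s)\<close>. These are distinct
  for distinct rounds, so their values are independent Laplace variables, exactly like the first
  \<open>n\<close> coordinates of \<open>laplace_seq\<close>; both laws are compared through the
  finite product \<open>?P\<close>.\<close>

lemma integral_noise_path_prob:
  fixes l :: losses
  assumes B: "bandit_algorithm K B" and J: "J \<in> action_lists K n" and lam: "lam > 0" and nm: "n \<le> m"
  defines "F \<equiv> \<lambda>Z. path_prob B J (\<lambda>s. l s (J ! s) + Z (s, J ! s))"
  shows "integrable (noise m K lam) F" "(\<integral>Z. F Z \<partial>noise m K lam) = smoothed B lam J (\<lambda>s. l s (J ! s))"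
proof -
  have J': "set J \<subseteq> {1..K}" "length J = n" using J by (auto simp: action_lists_def)
  interpret N: prob_space "noise m K lam"
    unfolding noise_def by (intro prob_space_PiM prob_space_laplace lam)
  interpret S: prob_space "laplace_seq lam" by (rule prob_space_laplace_seq[OF lam])
  let ?f = "\<lambda>s. (s, J ! s)" and ?P = "\<Pi>\<^sub>M s\<in>{..<n}. laplace lam"
  let ?G = "\<lambda>Z. path_prob B J (\<lambda>s. l s (J ! s) + Z s)"
  have f: "?f \<in> {..<n} \<rightarrow> {..<m} \<times> {1..K}" "inj_on ?f {..<n}"
    using action_listsD[OF J] nm by (auto simp: inj_on_def)
  have r1: "distr (noise m K lam) ?P (\<lambda>Z. \<lambda>s\<in>{..<n}. Z (?f s)) = ?P"
    unfolding noise_def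
    using distr_PiM_reindex[of "{..<m} \<times> {1..K}" "\<lambda>_. laplace lam", OF prob_space_laplace[OF lam] f(2,1)] .
  have r2: "distr (laplace_seq lam) ?P (\<lambda>Z. \<lambda>s\<in>{..<n}. Z s) = ?P"
    using distr_PiM_reindex[of UNIV "\<lambda>_. laplace lam" id "{..<n}", OF prob_space_laplace[OF lam]] by simp
  have G: "?G \<in> borel_measurable ?P"
  proof (rule measurable_path_prob[OF B J'(1)])
    fix s assume "Suc s < length J"
    then have "(\<lambda>Z. Z s) \<in> borel_measurable ?P"
      using measurable_component_singleton[of s "{..<n}" "\<lambda>_. laplace lam"] J' by (simp cong: measurable_cong_sets)
    then show "(\<lambda>Z. l s (J ! s) + Z s) \<in> borel_measurable ?P" by simp
  qed
  have m1: "(\<lambda>Z. \<lambda>s\<in>{..<n}. Z (?f s)) \<in> noise m K lam \<rightarrow>\<^sub>M ?P"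
    unfolding noise_def using f(1) by (intro measurable_restrict measurable_component_singleton) auto
  have m2: "(\<lambda>Z. \<lambda>s\<in>{..<n}. Z s) \<in> laplace_seq lam \<rightarrow>\<^sub>M ?P"
    by (intro measurable_restrict measurable_component_singleton) auto
  have FG: "F Z = ?G (\<lambda>s\<in>{..<n}. Z (?f s))" for Z
    unfolding F_def using J' by (intro path_prob_cong) auto
  show "integrable (noise m K lam) F"
    using measurable_compose[OF m1 G] unfolding FG[symmetric]
    by (intro N.integrable_const_bound[where B = 1]) (auto simp: F_def)
  have "(\<integral>Z. F Z \<partial>noise m K lam) = (\<integral>Z. ?G Z \<partial>?P)"
    unfolding FG using integral_distr[OF m1 G] r1 by simp
  also have "\<dots> = (\<integral>Z. ?G (\<lambda>s\<in>{..<n}. Z s) \<partial>laplace_seq lam)"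
    using integral_distr[OF m2 G] r2 by simp
  also have "\<dots> = smoothed B lam J (\<lambda>s. l s (J ! s))"
    unfolding smoothed_def using J' by (intro Bochner_Integration.integral_cong refl path_prob_cong) auto
  finally show "(\<integral>Z. F Z \<partial>noise m K lam) = smoothed B lam J (\<lambda>s. l s (J ! s))" .
qed

text \<open>The coordinate \<open>a s\<close> is observed only before round \<open>Suc s\<close>, so the average of the last block, which
  may involve unconstrained losses beyond the horizon, does not matter.\<close>

lemma smoothed_le_of_close:
  assumes B: "bandit_algorithm K B" and J: "set J \<subseteq> {1..K}" and lam: "lam > 0" and d: "d \<ge> 0"
    and a: "\<And>s. Suc s < length J \<Longrightarrow> s \<noteq> c \<Longrightarrow> a s = a' s"
    and c: "Suc c < length J \<Longrightarrow> \<bar>a c - a' c\<bar> \<le> d"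
  shows "smoothed B lam J a \<le> exp (d / lam) * smoothed B lam J a'"
proof -
  \<comment> \<open>Zeroing the coordinates that are not read makes the two sequences agree
    everywhere except possibly at \<open>c\<close>. If \<open>c\<close> itself is not read, the
    remaining distance is 0, which \<open>d\<close> dominates by nonnegativity.\<close>
  let ?cut = "\<lambda>a s. if Suc s < length J then a s else (0 :: real)"
  have cut: "smoothed B lam J b = smoothed B lam J (?cut b)" for b
    by (intro smoothed_cong) auto
  have "smoothed B lam J (?cut a)
      \<le> exp (\<bar>?cut a c - ?cut a' c\<bar> / lam) * smoothed B lam J (?cut a')"
    using a by (intro smoothed_le[OF B J lam]) auto
  also have "\<dots> \<le> exp (d / lam) * smoothed B lam J (?cut a')"
    using c d lam by (intro mult_right_mono) (auto intro!: divide_right_mono)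
  finally show ?thesis using cut by simp
qed

lemma bandit_algorithm_pos:
  assumes "bandit_algorithm K B"
  shows "1 \<le> K"
proof -
  have "set_pmf (B []) \<subseteq> {1..K}" using assms by (simp add: bandit_algorithm_def)
  moreover have "set_pmf (B []) \<noteq> {}" by (rule set_pmf_not_empty)
  ultimately have "{1..K} \<noteq> {}" by blast
  then show ?thesis by simp
qed

section \<open>The batched algorithm\<close>

text \<open>A zero denominator means that the past \<open>J\<close> is impossible; the default
  action 1 only keeps the value a distribution on the action set, which is nonempty by
  \<open>bandit_algorithm_pos\<close>.\<close>

definition conditional_law :: "nat \<Rightarrow> bandit \<Rightarrow> real \<Rightarrow> nat list \<Rightarrow> (nat \<Rightarrow> real) \<Rightarrow> nat pmf" where
  "conditional_law K B lam J a =
     (if smoothed B lam J a = 0 then return_pmf 1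
      else embed_pmf (\<lambda>j. if j \<in> {1..K} then smoothed B lam (J @ [j]) a / smoothed B lam J a else 0))"

lemma pmf_conditional_law:
  assumes B: "bandit_algorithm K B" and J: "set J \<subseteq> {1..K}" and lam: "lam > 0"
  shows "pmf (conditional_law K B lam J a) j =
     (if smoothed B lam J a = 0 then indicator {1} j
      else if j \<in> {1..K} then smoothed B lam (J @ [j]) a / smoothed B lam J a else 0)"
proof (cases "smoothed B lam J a = 0")
  case True
  then show ?thesis by (auto simp: conditional_law_def indicator_def)
next
  case False
  let ?f = "\<lambda>j. if j \<in> {1..K} then smoothed B lam (J @ [j]) a / smoothed B lam J a else 0"
  have "(\<integral>\<^sup>+j. ennreal (?f j) \<partial>count_space UNIV) = (\<Sum>j\<in>{1..K}. ennreal (?f j))"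
    by (intro nn_integral_count_space') auto
  also have "\<dots> = ennreal (\<Sum>j\<in>{1..K}. smoothed B lam (J @ [j]) a / smoothed B lam J a)"
    by (subst sum_ennreal[symmetric]) (auto intro!: sum.cong)
  also have "\<dots> = 1"
    using False by (simp add: sum_divide_distrib[symmetric] sum_smoothed_snoc[OF B J lam] del: One_nat_def)
  finally have "pmf (embed_pmf ?f) j = ?f j"
    by (intro pmf_embed_pmf) auto
  then show ?thesis using False by (simp add: conditional_law_def)
qed

text \<open>The chain rule survives the default: if \<open>J\<close> has probability 0, its
  extensions have nonnegative probabilities summing to 0, so both sides vanish.\<close>

lemma smoothed_mult_conditional_law:
  assumes B: "bandit_algorithm K B" and J: "set J \<subseteq> {1..K}" and lam: "lam > 0" and j: "j \<in> {1..K}"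
  shows "smoothed B lam J a * pmf (conditional_law K B lam J a) j = smoothed B lam (J @ [j]) a"
proof (cases "smoothed B lam J a = 0")
  case True
  then have "(\<Sum>j\<in>{1..K}. smoothed B lam (J @ [j]) a) = 0"
    using sum_smoothed_snoc[OF B J lam] by simp
  then have "smoothed B lam (J @ [j]) a = 0"
    using j by (subst (asm) sum_nonneg_eq_0_iff) auto
  then show ?thesis using True by simp
qed (use pmf_conditional_law[OF B J lam] j in auto)

lemma set_pmf_conditional_law:
  assumes B: "bandit_algorithm K B" and J: "set J \<subseteq> {1..K}" and lam: "lam > 0"
  shows "set_pmf (conditional_law K B lam J a) \<subseteq> {1..K}"
  using bandit_algorithm_pos[OF B]
  by (auto simp: set_pmf_eq pmf_conditional_law[OF assms] indicator_def split: if_splits)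

text \<open>\<open>blocks\<close> rounds the number of blocks up: a final incomplete block has already chosen its action.\<close>

definition blocks :: "nat \<Rightarrow> 'a list \<Rightarrow> 'a list" where
  "blocks \<tau> xs = map (\<lambda>c. xs ! (c * \<tau>)) [0..<(length xs + \<tau> - 1) div \<tau>]"

text \<open>The index \<open>t div \<tau> * \<tau>\<close> is the first round of the block
  containing \<open>t\<close>. Lists violating this condition have probability 0 under the batched
  algorithm.\<close>

definition block_const :: "nat \<Rightarrow> 'a list \<Rightarrow> bool" where
  "block_const \<tau> xs \<longleftrightarrow> (\<forall>t<length xs. xs ! t = xs ! (t div \<tau> * \<tau>))"

definition block_avg :: "nat \<Rightarrow> (nat \<Rightarrow> real) \<Rightarrow> nat \<Rightarrow> real" where
  "block_avg \<tau> f c = (\<Sum>t\<in>{c * \<tau>..<c * \<tau> + \<tau>}. f t) / real \<tau>"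

lemma less_length_blocks_iff: "\<tau> > 0 \<Longrightarrow> c < length (blocks \<tau> xs) \<longleftrightarrow> c * \<tau> < length xs"
  \<comment> \<open>Block \<open>c\<close> exists if \<open>(c + 1) * \<tau>\<close> is at most
    \<open>length xs + \<tau> - 1\<close>, which is the same as its first round lying inside the
    list.\<close>
  using less_eq_div_iff_mult_less_eq[of \<tau> "Suc c" "length xs + \<tau> - 1"]
  by (auto simp: blocks_def less_eq_Suc_le[of c])

lemma nth_blocks: "c < length (blocks \<tau> xs) \<Longrightarrow> blocks \<tau> xs ! c = xs ! (c * \<tau>)"
  by (simp add: blocks_def)

lemma set_blocks: "\<tau> > 0 \<Longrightarrow> set (blocks \<tau> xs) \<subseteq> set xs"
  by (auto simp: set_conv_nth[of "blocks \<tau> xs"] less_length_blocks_iff nth_blocks)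

lemma length_blocks_dvd: "\<tau> > 0 \<Longrightarrow> \<tau> dvd length xs \<Longrightarrow> length (blocks \<tau> xs) = length xs div \<tau>"
  by (auto simp: blocks_def intro!: div_nat_eqI elim!: dvdE)

lemma length_blocks_not_dvd:
  assumes "\<tau> > 0" "\<not> \<tau> dvd length xs"
  shows "length (blocks \<tau> xs) = Suc (length xs div \<tau>)"
proof -
  have "c < length (blocks \<tau> xs) \<longleftrightarrow> c < Suc (length xs div \<tau>)" for c
  proof -
    \<comment> \<open>Without divisibility, the weak inequality delivered by the quotient agrees
      with the strict one characterising existing blocks.\<close>
    have "c * \<tau> \<noteq> length xs" using assms(2) by (metis dvd_triv_right)
    moreover have "c < Suc (length xs div \<tau>) \<longleftrightarrow> c * \<tau> \<le> length xs"
      unfolding less_Suc_eq_le by (rule less_eq_div_iff_mult_less_eq[OF assms(1)])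
    ultimately show ?thesis using less_length_blocks_iff[OF assms(1), of c xs] by linarith
  qed
  then show ?thesis by (metis less_irrefl linorder_neqE_nat)
qed

lemma blocks_snoc:
  assumes "\<tau> > 0"
  shows "blocks \<tau> (xs @ [i]) = (if \<tau> dvd length xs then blocks \<tau> xs @ [i] else blocks \<tau> xs)"
proof -
  have len: "length (blocks \<tau> (xs @ [i])) = Suc (length xs div \<tau>)"
    using assms by (simp add: blocks_def)
  show ?thesis
  proof (cases "\<tau> dvd length xs")
    case True
    have "blocks \<tau> (xs @ [i]) = blocks \<tau> xs @ [i]"
    proof (rule nth_equalityI)
      fix c assume "c < length (blocks \<tau> (xs @ [i]))"
      then have c: "c \<le> length xs div \<tau>" "c < length (blocks \<tau> (xs @ [i]))" using len by auto
      show "blocks \<tau> (xs @ [i]) ! c = (blocks \<tau> xs @ [i]) ! c"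
      proof (cases "c = length xs div \<tau>")
        case True
        then show ?thesis using c assms \<open>\<tau> dvd _\<close> by (simp add: nth_blocks length_blocks_dvd nth_append)
      next
        case False
        then have "c < length (blocks \<tau> xs)" using c True assms by (simp add: length_blocks_dvd)
        then show ?thesis using c assms
          by (simp add: nth_blocks nth_append less_length_blocks_iff)
      qed
    qed (use assms True len in \<open>simp add: length_blocks_dvd\<close>)
    then show ?thesis using True by simp
  next
    case False
    have "blocks \<tau> (xs @ [i]) = blocks \<tau> xs"
    proof (rule nth_equalityI)
      fix c assume "c < length (blocks \<tau> (xs @ [i]))"
      then have c: "c < length (blocks \<tau> (xs @ [i]))" "c < length (blocks \<tau> xs)"
        using len False assms by (auto simp: length_blocks_not_dvd)
      then show "blocks \<tau> (xs @ [i]) ! c = blocks \<tau> xs ! c"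
        using assms by (simp add: nth_blocks nth_append less_length_blocks_iff)
    qed (use assms False len in \<open>simp add: length_blocks_not_dvd\<close>)
    then show ?thesis using False by simp
  qed
qed

lemma block_const_snoc:
  assumes "\<tau> > 0"
  shows "block_const \<tau> (xs @ [i]) \<longleftrightarrow>
    block_const \<tau> xs \<and> (\<tau> dvd length xs \<or> i = xs ! (length xs div \<tau> * \<tau>))"
proof -
  have *: "t div \<tau> * \<tau> < length xs" if "t < length xs" for t
    using that by (meson div_times_less_eq_dividend le_less_trans)
  have **: "length xs div \<tau> * \<tau> < length xs \<longleftrightarrow> \<not> \<tau> dvd length xs"
    by (metis div_times_less_eq_dividend dvd_div_mult_self dvd_triv_right le_less less_irrefl)
  show ?thesis
    unfolding block_const_def using * **
    by (auto simp: nth_append less_Suc_eq all_conj_distrib)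
qed

lemma block_avg_cong:
  "(\<And>t. c * \<tau> \<le> t \<Longrightarrow> t < c * \<tau> + \<tau> \<Longrightarrow> f t = g t) \<Longrightarrow> block_avg \<tau> f c = block_avg \<tau> g c"
  unfolding block_avg_def by (intro arg_cong2[where f = "(/)"] sum.cong) auto

text \<open>A new action is drawn only at the start of a block; inside a block its first action is
  repeated. At a block start \<open>block_avg\<close> is meaningful only for the complete past
  blocks, and by \<open>smoothed_cong\<close> the conditional law reads no other coordinate.\<close>

definition batched :: "nat \<Rightarrow> bandit \<Rightarrow> nat \<Rightarrow> real \<Rightarrow> bandit" where
  "batched K B \<tau> lam h =
     (if \<tau> dvd length h
      then conditional_law K B lam (blocks \<tau> (map fst h)) (block_avg \<tau> (\<lambda>t. snd (h ! t)))
      else return_pmf (fst (h ! (length h div \<tau> * \<tau>))))"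

lemma block_index_less: "(\<tau> :: nat) > 0 \<Longrightarrow> c < n div \<tau> \<Longrightarrow> c * \<tau> + \<tau> \<le> n"
  by (metis Suc_leI add.commute less_eq_div_iff_mult_less_eq mult_Suc)

lemma div_eq_of_block: "c * \<tau> \<le> t \<Longrightarrow> t < c * \<tau> + \<tau> \<Longrightarrow> t div \<tau> = (c :: nat)"
  by (metis add.commute div_nat_eqI mult.commute mult_Suc)

lemma not_dvd_div_mult_less: "\<not> \<tau> dvd n \<Longrightarrow> n div \<tau> * \<tau> < (n :: nat)"
  by (metis div_times_less_eq_dividend dvd_triv_right le_less)

lemma bandit_algorithm_batched:
  assumes B: "bandit_algorithm K B" and tau: "\<tau> > 0" and lam: "lam > 0"
  shows "bandit_algorithm K (batched K B \<tau> lam)"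
  unfolding bandit_algorithm_def
proof (intro conjI allI impI ballI)
  fix h :: "(nat \<times> real) list" assume h: "fst ` set h \<subseteq> {1..K}"
  show "set_pmf (batched K B \<tau> lam h) \<subseteq> {1..K}"
  proof (cases "\<tau> dvd length h")
    case True
    have "set (blocks \<tau> (map fst h)) \<subseteq> {1..K}"
      using set_blocks[OF tau, of "map fst h"] h by auto
    then show ?thesis
      using True set_pmf_conditional_law[OF B _ lam] by (simp add: batched_def)
  next
    case False
    then have "fst (h ! (length h div \<tau> * \<tau>)) \<in> fst ` set h"
      by (intro imageI nth_mem not_dvd_div_mult_less)
    then show ?thesis using h False by (auto simp: batched_def)
  qed
next
  fix n i :: nat assume i: "i \<in> {1..K}"
  let ?M = "\<Pi>\<^sub>M s\<in>{..<n}. count_space {1..K} \<Otimes>\<^sub>M (borel :: real measure)"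
  have fst_meas: "(\<lambda>h. fst (h k)) \<in> ?M \<rightarrow>\<^sub>M count_space {1..K}" if "k < n" for k
    using that
    by (intro measurable_compose[OF measurable_component_singleton[of k "{..<n}" "\<lambda>_. count_space {1..K} \<Otimes>\<^sub>M borel"] measurable_fst]) auto
  have snd_meas: "(\<lambda>h. snd (h k)) \<in> borel_measurable ?M" if "k < n" for k
    using that
    by (intro measurable_compose[OF measurable_component_singleton[of k "{..<n}" "\<lambda>_. count_space {1..K} \<Otimes>\<^sub>M borel"] measurable_snd]) auto
  show "(\<lambda>h. pmf (batched K B \<tau> lam (map h [0..<n])) i) \<in> borel_measurable ?M"
  proof (cases "\<tau> dvd n")
    case False
    then have k: "n div \<tau> * \<tau> < n" by (rule not_dvd_div_mult_less)
    have "(\<lambda>h. pmf (return_pmf (fst (h (n div \<tau> * \<tau>)))) i) \<in> borel_measurable ?M"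
      by (rule measurable_compose[OF fst_meas[OF k]]) simp
    then show ?thesis using False k by (simp add: batched_def)
  next
    case True
    let ?J = "\<lambda>h. blocks \<tau> (map fst (map h [0..<n]))"
    let ?a = "\<lambda>h. block_avg \<tau> (\<lambda>t. snd (map h [0..<n] ! t))"
    have a: "(\<lambda>h. ?a h c) \<in> borel_measurable ?M" if c: "c < n div \<tau>" for c
    proof -
      note le = block_index_less[OF tau c]
      have "?a h c = block_avg \<tau> (\<lambda>t. snd (h t)) c" for h :: "nat \<Rightarrow> nat \<times> real"
        using le by (intro block_avg_cong) auto
      moreover have "(\<lambda>h. block_avg \<tau> (\<lambda>t. snd (h t)) c) \<in> borel_measurable ?M"
        unfolding block_avg_def using le by (intro borel_measurable_divide borel_measurable_sum snd_meas) auto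
      ultimately show ?thesis by simp
    qed
    have "(\<lambda>h. pmf (conditional_law K B lam (?J h) (?a h)) i) \<in> borel_measurable ?M"
    \<comment> \<open>The list of past block actions takes finitely many values. It can therefore be
      frozen as \<open>J\<close>, which leaves a quotient of smoothed probabilities, measurable in
      the averages.\<close>
    proof (rule measurable_compose_countable'[where I = "action_lists K (n div \<tau>)"
          and f = "\<lambda>J h. pmf (conditional_law K B lam J (?a h)) i"])
      fix J assume J: "J \<in> action_lists K (n div \<tau>)"
      then have J': "set J \<subseteq> {1..K}" "length J = n div \<tau>" by (auto simp: action_lists_def)
      have [measurable]: "(\<lambda>h. smoothed B lam J (?a h)) \<in> borel_measurable ?M"
        using J' by (intro measurable_smoothed[OF B _ lam] a) auto
      have [measurable]: "(\<lambda>h. smoothed B lam (J @ [i]) (?a h)) \<in> borel_measurable ?M"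
        using J' i by (intro measurable_smoothed[OF B _ lam] a) auto
      show "(\<lambda>h. pmf (conditional_law K B lam J (?a h)) i) \<in> borel_measurable ?M"
        unfolding pmf_conditional_law[OF B J'(1) lam] by measurable
    next
      have len: "length (?J h) = n div \<tau>" for h :: "nat \<Rightarrow> nat \<times> real"
        using True tau by (simp add: length_blocks_dvd)
      have nth: "?J h ! c = fst (h (c * \<tau>))" if "c < n div \<tau>" for h :: "nat \<Rightarrow> nat \<times> real" and c
        using block_index_less[OF tau that] tau that len[of h] by (subst nth_blocks) auto
      show "?J \<in> ?M \<rightarrow>\<^sub>M count_space (action_lists K (n div \<tau>))"
      proof (subst measurable_count_space_eq2, simp, intro conjI ballI funcsetI)
        fix h assume h: "h \<in> space ?M"
        have "fst (h k) \<in> {1..K}" if "k < n" for k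
          using measurable_space[OF fst_meas[OF that] h] by simp
        then have "set (map fst (map h [0..<n])) \<subseteq> {1..K}" by auto
        then show "?J h \<in> action_lists K (n div \<tau>)"
          using set_blocks[OF tau, of "map fst (map h [0..<n])"] len by (auto simp: action_lists_def)
      next
        fix J assume J: "J \<in> action_lists K (n div \<tau>)"
        have "?J -` {J} \<inter> space ?M = {h \<in> space ?M. \<forall>c\<in>{..<n div \<tau>}. fst (h (c * \<tau>)) = J ! c}"
          using len nth action_listsD(1)[OF J] by (auto simp: list_eq_iff_nth_eq simp del: map_map)
        also have "\<dots> \<in> sets ?M"
        proof (intro sets.sets_Collect_finite_All)
          fix c assume c: "c \<in> {..<n div \<tau>}"
          then have "(\<lambda>h. fst (h (c * \<tau>))) \<in> ?M \<rightarrow>\<^sub>M count_space {1..K}"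
            using block_index_less[OF tau, of c n] tau by (intro fst_meas) auto
          from measurable_sets[OF this, of "{J ! c}"]
          show "{h \<in> space ?M. fst (h (c * \<tau>)) = J ! c} \<in> sets ?M"
            using action_listsD(2)[OF J, of c] c by (auto simp: vimage_def Int_def conj_commute)
        qed auto
        finally show "?J -` {J} \<inter> space ?M \<in> sets ?M" .
      qed
    qed (simp add: countable_finite)
    then show ?thesis using True by (simp add: batched_def)
  qed
qed

text \<open>Induction on the last round. At a block start the new factor has as denominator the
  probability accumulated so far, so the product telescopes; inside a block the factor is 1 if the
  action is repeated and 0 otherwise.\<close>

lemma pmf_actions_batched:
  assumes B: "bandit_algorithm K B" and tau: "\<tau> > 0" and lam: "lam > 0" and xs: "xs \<in> action_lists K n"
  shows "pmf (actions (batched K B \<tau> lam) f n) xs =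
    (if block_const \<tau> xs
     then smoothed B lam (blocks \<tau> xs) (\<lambda>c. block_avg \<tau> (\<lambda>t. f t (blocks \<tau> xs ! c)) c) else 0)"
  using xs
proof (induction xs arbitrary: n rule: rev_induct)
  case Nil
  then show ?case using tau lam by (simp add: action_lists_def block_const_def blocks_def)
next
  case (snoc i xs)
  let ?a = "\<lambda>J c. block_avg \<tau> (\<lambda>t. f t (J ! c)) c"
  define m where "m = length xs"
  have n: "n = Suc m" and xs: "xs \<in> action_lists K m" "set xs \<subseteq> {1..K}" and i: "i \<in> {1..K}"
    using snoc.prems by (auto simp: action_lists_def m_def)
  have J: "set (blocks \<tau> xs) \<subseteq> {1..K}" using set_blocks[OF tau, of xs] xs(2) by blast
  have fst_hist: "map fst (history f xs) = xs" "length (history f xs) = m"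
    by (auto simp: history_def m_def comp_def map_nth)
  have step: "pmf (actions (batched K B \<tau> lam) f n) (xs @ [i])
      = (if block_const \<tau> xs then smoothed B lam (blocks \<tau> xs) (?a (blocks \<tau> xs)) else 0)
        * pmf (batched K B \<tau> lam (history f xs)) i"
    unfolding n pmf_actions_snoc snoc.IH[OF xs(1)] ..
  consider "\<not> block_const \<tau> xs" | "block_const \<tau> xs" "\<tau> dvd m" | "block_const \<tau> xs" "\<not> \<tau> dvd m" by blast
  then show ?case
  proof cases
    case 1
    then show ?thesis unfolding step block_const_snoc[OF tau] by simp
  next
    case 2
    let ?b = "block_avg \<tau> (\<lambda>t. snd (history f xs ! t))"
    \<comment> \<open>On a block-constant list the losses actually observed in block
      \<open>c\<close> are those of the action \<open>blocks \<tau> xs ! c\<close>, so the averages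
      computed from the history are the intended ones.\<close>
    have ab: "?a (blocks \<tau> xs) c = ?b c" if "c < length (blocks \<tau> xs)" for c
    proof (intro block_avg_cong)
      fix t assume t: "c * \<tau> \<le> t" "t < c * \<tau> + \<tau>"
      have "c < m div \<tau>" using that 2 tau by (simp add: length_blocks_dvd m_def)
      then have "t < m" using block_index_less[OF tau, of c m] t by simp
      moreover have "t div \<tau> = c" by (rule div_eq_of_block[OF t])
      ultimately have "xs ! t = xs ! (c * \<tau>)"
        using 2 by (auto simp: block_const_def m_def)
      then show "f t (blocks \<tau> xs ! c) = snd (history f xs ! t)"
        using \<open>t < m\<close> that by (simp add: history_def m_def nth_blocks)
    qed
    have "smoothed B lam (blocks \<tau> xs) (?a (blocks \<tau> xs)) = smoothed B lam (blocks \<tau> xs) ?b"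
      using ab by (intro smoothed_cong) auto
    moreover have "smoothed B lam (blocks \<tau> xs @ [i]) (?a (blocks \<tau> xs @ [i]))
        = smoothed B lam (blocks \<tau> xs @ [i]) ?b"
      using ab by (intro smoothed_cong) (auto simp: nth_append)
    ultimately show ?thesis
      unfolding step block_const_snoc[OF tau] blocks_snoc[OF tau]
      using 2 smoothed_mult_conditional_law[OF B J lam i] fst_hist by (simp add: batched_def m_def)
  next
    case 3
    have "fst (history f xs ! (m div \<tau> * \<tau>)) = xs ! (m div \<tau> * \<tau>)"
      using not_dvd_div_mult_less[OF 3(2)] by (simp add: history_def m_def)
    then show ?thesis
      unfolding step block_const_snoc[OF tau] blocks_snoc[OF tau]
      using 3 fst_hist by (auto simp: batched_def m_def indicator_def)
  qed
qed

section \<open>Privacy of the batched algorithm\<close>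

lemma abs_block_avg_diff_le:
  assumes tau: "\<tau> > 0" and eq: "\<And>t. c * \<tau> \<le> t \<Longrightarrow> t < c * \<tau> + \<tau> \<Longrightarrow> t \<noteq> t0 \<Longrightarrow> f t = g t"
    and t0: "c * \<tau> \<le> t0" "t0 < c * \<tau> + \<tau>" and d: "\<bar>f t0 - g t0\<bar> \<le> 1"
  shows "\<bar>block_avg \<tau> f c - block_avg \<tau> g c\<bar> \<le> 1 / real \<tau>"
proof -
  have "block_avg \<tau> f c - block_avg \<tau> g c = (\<Sum>t\<in>{c * \<tau>..<c * \<tau> + \<tau>}. f t - g t) / real \<tau>"
    by (simp add: block_avg_def sum_subtractf diff_divide_distrib)
  also have "(\<Sum>t\<in>{c * \<tau>..<c * \<tau> + \<tau>}. f t - g t)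
      = (\<Sum>t\<in>{c * \<tau>..<c * \<tau> + \<tau>}. if t = t0 then f t0 - g t0 else 0)"
    using eq by (intro sum.cong) auto
  also have "\<dots> = f t0 - g t0" using t0 by simp
  finally show ?thesis using d tau by (simp add: divide_right_mono)
qed

text \<open>As \<open>delta\<close> is 0 and events are finite, it suffices to compare the
  probabilities of each single list of actions. For a fixed list the averages on both sides follow
  the same actions, so only the block containing the changed round can differ, by at most
  \<open>1 / \<tau>\<close>.\<close>

lemma differentially_private_batched:
  assumes B: "bandit_algorithm K B" and tau: "\<tau> > 0" and lam: "lam > 0"
    and eps: "1 / (real \<tau> * lam) \<le> eps"
  shows "differentially_private K eps 0 (batched K B \<tau> lam)"
  unfolding differentially_private_def
proof (intro allI ballI impI)
  fix T l l' E
  assume l: "l \<in> loss_seqs K T" "l' \<in> loss_seqs K T"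
    and ex1: "\<exists>!t. t < T \<and> (\<exists>i\<in>{1..K}. l t i \<noteq> l' t i)"
    and "E \<subseteq> {xs. length xs = T \<and> set xs \<subseteq> {1..K}}"
  then have E: "E \<subseteq> action_lists K T" by (simp add: action_lists_def)
  then have "finite E" by (rule finite_subset) simp
  obtain t0 where "t0 < T" and same: "\<And>t i. t < T \<Longrightarrow> i \<in> {1..K} \<Longrightarrow> t \<noteq> t0 \<Longrightarrow> l t i = l' t i"
    using ex1 by metis
  have close: "\<bar>l t0 i - l' t0 i\<bar> \<le> 1" if "i \<in> {1..K}" for i
  proof -
    have "0 \<le> l t0 i" "l t0 i \<le> 1" "0 \<le> l' t0 i" "l' t0 i \<le> 1"
      using l that \<open>t0 < T\<close> by (auto simp: loss_seqs_def)
    then show ?thesis by linarith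
  qed
  let ?p = "\<lambda>l. pmf (actions (batched K B \<tau> lam) l T)"
  have "?p l xs \<le> exp eps * ?p l' xs" if xs: "xs \<in> E" for xs
  proof (cases "block_const \<tau> xs")
    case True
    have xs': "xs \<in> action_lists K T" "length xs = T" "set xs \<subseteq> {1..K}"
      using xs E by (auto simp: action_lists_def)
    let ?J = "blocks \<tau> xs"
    let ?a = "\<lambda>l c. block_avg \<tau> (\<lambda>t. l t (?J ! c)) c"
    have J: "set ?J \<subseteq> {1..K}" using set_blocks[OF tau, of xs] xs' by blast
    \<comment> \<open>A block followed by another one is complete and ends within the horizon, where
      alone \<open>loss_seqs\<close> bounds the losses and the two sequences are known to agree off
      \<open>t0\<close>.\<close>
    have sJ: "?J ! s \<in> {1..K}" "s * \<tau> + \<tau> \<le> T" if "Suc s < length ?J" for s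
    proof -
      have "?J ! s \<in> set ?J" using that by (intro nth_mem) simp
      then show "?J ! s \<in> {1..K}" using J by blast
      show "s * \<tau> + \<tau> \<le> T" using that tau xs' by (simp add: less_length_blocks_iff add.commute)
    qed
    have "smoothed B lam ?J (?a l) \<le> exp ((1 / real \<tau>) / lam) * smoothed B lam ?J (?a l')"
    proof (rule smoothed_le_of_close[OF B J lam, where c = "t0 div \<tau>"])
      fix s assume s: "Suc s < length ?J" "s \<noteq> t0 div \<tau>"
      show "?a l s = ?a l' s"
      proof (intro block_avg_cong same sJ s)
        fix t assume t: "s * \<tau> \<le> t" "t < s * \<tau> + \<tau>"
        then show "t < T" using sJ(2)[OF s(1)] by simp
        have "t div \<tau> = s" by (rule div_eq_of_block[OF t])
        then show "t \<noteq> t0" using s by auto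
      qed
    next
      assume s: "Suc (t0 div \<tau>) < length ?J"
      show "\<bar>?a l (t0 div \<tau>) - ?a l' (t0 div \<tau>)\<bar> \<le> 1 / real \<tau>"
      proof (rule abs_block_avg_diff_le[OF tau])
        show "t0 div \<tau> * \<tau> \<le> t0" by simp
        show "t0 < t0 div \<tau> * \<tau> + \<tau>" using dividend_less_div_times[OF tau, of t0] by (simp add: add.commute)
        show "\<bar>l t0 (?J ! (t0 div \<tau>)) - l' t0 (?J ! (t0 div \<tau>))\<bar> \<le> 1" by (rule close[OF sJ(1)[OF s]])
        fix t assume "t < t0 div \<tau> * \<tau> + \<tau>" "t \<noteq> t0"
        then show "l t (?J ! (t0 div \<tau>)) = l' t (?J ! (t0 div \<tau>))"
          using sJ(2)[OF s] by (intro same sJ(1)[OF s]) simp_all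
      qed
    qed simp
    also have "\<dots> \<le> exp eps * smoothed B lam ?J (?a l')"
      using eps by (intro mult_right_mono) simp_all
    finally show ?thesis
      using True by (simp add: pmf_actions_batched[OF B tau lam xs'(1)])
  next
    case False
    moreover have "xs \<in> action_lists K T" using xs E by blast
    ultimately show ?thesis by (simp add: pmf_actions_batched[OF B tau lam])
  qed
  then show "measure_pmf.prob (actions (batched K B \<tau> lam) l T) E
      \<le> exp eps * measure_pmf.prob (actions (batched K B \<tau> lam) l' T) E + 0"
    unfolding measure_measure_pmf_finite[OF \<open>finite E\<close>] sum_distrib_left add_0_right
    by (rule sum_mono)
qed

section \<open>Regret\<close>

text \<open>The bridge to the noisy regret: averaged over the noise, the play of \<open>B\<close>
  has the law \<open>smoothed\<close>. The noise space may have a longer horizon than the run, as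
  the monotonicity argument requires.\<close>

lemma integral_noise_expectation:
  assumes B: "bandit_algorithm K B" and lam: "lam > 0" and nm: "n \<le> m"
  shows "(\<integral>Z. measure_pmf.expectation (actions B (\<lambda>t i. l t i + Z (t, i)) n) g \<partial>noise m K lam)
    = (\<Sum>J\<in>action_lists K n. g J * smoothed B lam J (\<lambda>s. l s (J ! s)))"
proof -
  have "(\<integral>Z. measure_pmf.expectation (actions B (\<lambda>t i. l t i + Z (t, i)) n) g \<partial>noise m K lam)
      = (\<integral>Z. (\<Sum>J\<in>action_lists K n. g J * path_prob B J (\<lambda>s. l s (J ! s) + Z (s, J ! s))) \<partial>noise m K lam)"
    unfolding expectation_actions[OF B]
    by (intro Bochner_Integration.integral_cong sum.cong refl)
      (simp add: pmf_actions_eq_path_prob action_listsD)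
  also have "\<dots> = (\<Sum>J\<in>action_lists K n. \<integral>Z. g J * path_prob B J (\<lambda>s. l s (J ! s) + Z (s, J ! s)) \<partial>noise m K lam)"
    by (intro Bochner_Integration.integral_sum integrable_mult_right integral_noise_path_prob(1)[OF B _ lam nm])
  also have "\<dots> = (\<Sum>J\<in>action_lists K n. g J * smoothed B lam J (\<lambda>s. l s (J ! s)))"
    by (simp add: integral_noise_path_prob(2)[OF B _ lam nm])
  finally show ?thesis .
qed

text \<open>The values inserted into \<open>smoothed\<close> vary with \<open>J\<close>; the sum is
  the total mass of the law of play, obtained with the constant function 1.\<close>

lemma sum_smoothed:
  fixes l :: losses
  assumes B: "bandit_algorithm K B" and lam: "lam > 0"
  shows "(\<Sum>J\<in>action_lists K n. smoothed B lam J (\<lambda>s. l s (J ! s))) = 1"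
proof -
  interpret prob_space "noise n K lam"
    unfolding noise_def by (intro prob_space_PiM prob_space_laplace lam)
  show ?thesis
    using integral_noise_expectation[OF B lam order_refl, where m = n and l = l and g = "\<lambda>_. 1"] by (simp add: prob_space)
qed

lemma expectation_actions_truncate:
  assumes "n \<le> m"
  shows "measure_pmf.expectation (actions A f m) (\<lambda>xs. \<Sum>t<n. l t (xs ! t)) = expected_loss A f l n"
  unfolding expected_loss_def map_take_actions[OF assms, of A f, symmetric] integral_map_pmf
  by simp

lemma best_loss_le: "i \<in> {1..K} \<Longrightarrow> best_loss l T K \<le> (\<Sum>t<T. l t i)"
  unfolding best_loss_def by (intro cINF_lower bdd_below_finite finite_imageI) auto

lemma best_loss_nonneg:
  assumes "l \<in> loss_seqs K T" "1 \<le> K"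
  shows "0 \<le> best_loss l T K"
  unfolding best_loss_def using assms
  by (intro cINF_greatest sum_nonneg) (auto simp: loss_seqs_def)

lemma loss_seqs_nonempty: "loss_seqs K T \<noteq> {}"
proof -
  have "(\<lambda>_ _. 0) \<in> loss_seqs K T" by (simp add: loss_seqs_def)
  then show ?thesis by blast
qed

lemma noisy_regret_summand_eq:
  assumes "bandit_algorithm K B" "lam > 0"
  shows "(\<integral>Z. expected_loss B (\<lambda>t i. l t i + Z (t, i)) l n \<partial>noise n K lam)
    = (\<Sum>J\<in>action_lists K n. (\<Sum>t<n. l t (J ! t)) * smoothed B lam J (\<lambda>s. l s (J ! s)))"
  unfolding expected_loss_def by (rule integral_noise_expectation[OF assms order_refl])

text \<open>A real supremum bounds its members only if the set is bounded above. Here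
  \<open>n\<close> is a bound, as each round costs at most 1 and the best loss is
  nonnegative.\<close>

lemma noisy_regret_nat_upper:
  assumes B: "bandit_algorithm K B" and lam: "lam > 0" and l: "l \<in> loss_seqs K n"
  shows "(\<Sum>J\<in>action_lists K n. (\<Sum>t<n. l t (J ! t)) * smoothed B lam J (\<lambda>s. l s (J ! s)))
    - best_loss l n K \<le> noisy_regret_nat B n K lam"
proof -
  let ?r = "\<lambda>l. (\<integral>Z. expected_loss B (\<lambda>t i. l t i + Z (t, i)) l n \<partial>noise n K lam) - best_loss l n K"
  have "?r l \<le> real n" if l: "l \<in> loss_seqs K n" for l
  proof -
    have "(\<Sum>J\<in>action_lists K n. (\<Sum>t<n. l t (J ! t)) * smoothed B lam J (\<lambda>s. l s (J ! s)))
        \<le> (\<Sum>J\<in>action_lists K n. real n * smoothed B lam J (\<lambda>s. l s (J ! s)))"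
    proof (intro sum_mono mult_right_mono smoothed_nonneg)
      fix J assume J: "J \<in> action_lists K n"
      have "(\<Sum>t<n. l t (J ! t)) \<le> (\<Sum>t<n. 1)"
        using l action_listsD(2)[OF J] by (intro sum_mono) (simp add: loss_seqs_def)
      then show "(\<Sum>t<n. l t (J ! t)) \<le> real n" by simp
    qed
    also have "\<dots> = real n" using sum_smoothed[OF B lam, where n = n and l = l] by (simp add: sum_distrib_left[symmetric])
    finally show ?thesis
      using best_loss_nonneg[OF l bandit_algorithm_pos[OF B]]
      unfolding noisy_regret_summand_eq[OF B lam] by linarith
  qed
  then have "bdd_above (?r ` loss_seqs K n)" by (intro bdd_aboveI[of _ "real n"]) auto
  from cSUP_upper[OF l this] show ?thesis
    unfolding noisy_regret_nat_def noisy_regret_summand_eq[OF B lam] .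
qed

text \<open>Extending a loss sequence by zeros changes neither the loss incurred nor the best loss.\<close>

lemma noisy_regret_nat_mono:
  assumes B: "bandit_algorithm K B" and lam: "lam > 0" and nm: "n \<le> m"
  shows "noisy_regret_nat B n K lam \<le> noisy_regret_nat B m K lam"
  unfolding noisy_regret_nat_def[of B n]
proof (rule cSUP_least[OF loss_seqs_nonempty])
  fix l assume l: "l \<in> loss_seqs K n"
  define l' where "l' = (\<lambda>t i. if t < n then l t i else 0)"
  have l': "l' \<in> loss_seqs K m" using l by (auto simp: l'_def loss_seqs_def)
  have sum: "(\<Sum>t<m. l' t (f t)) = (\<Sum>t<n. l t (f t))" for f
    unfolding l'_def using nm by (intro sum.mono_neutral_cong_right) auto
  have "(\<Sum>J\<in>action_lists K m. (\<Sum>t<m. l' t (J ! t)) * smoothed B lam J (\<lambda>s. l' s (J ! s)))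
      = (\<integral>Z. measure_pmf.expectation (actions B (\<lambda>t i. l' t i + Z (t, i)) m) (\<lambda>xs. \<Sum>t<n. l t (xs ! t)) \<partial>noise m K lam)"
    unfolding integral_noise_expectation[OF B lam order_refl] sum ..
  \<comment> \<open>Rounds from \<open>n\<close> on cost nothing and do not influence the earlier
    actions, so the run may be stopped after \<open>n\<close> rounds.\<close>
  also have "\<dots> = (\<integral>Z. expected_loss B (\<lambda>t i. l' t i + Z (t, i)) l n \<partial>noise m K lam)"
    by (simp add: expectation_actions_truncate[OF nm])
  also have "\<dots> = (\<Sum>J\<in>action_lists K n. (\<Sum>t<n. l t (J ! t)) * smoothed B lam J (\<lambda>s. l' s (J ! s)))"
    unfolding expected_loss_def by (rule integral_noise_expectation[OF B lam nm])
  also have "\<dots> = (\<Sum>J\<in>action_lists K n. (\<Sum>t<n. l t (J ! t)) * smoothed B lam J (\<lambda>s. l s (J ! s)))"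
    by (intro sum.cong refl arg_cong2[where f = "(*)"] smoothed_cong) (auto simp: l'_def action_listsD)
  finally show "(\<integral>Z. expected_loss B (\<lambda>t i. l t i + Z (t, i)) l n \<partial>noise n K lam) - best_loss l n K
      \<le> noisy_regret_nat B m K lam"
    using noisy_regret_nat_upper[OF B lam l']
    unfolding noisy_regret_summand_eq[OF B lam] by (simp add: best_loss_def sum[of "\<lambda>_. _"])
qed

text \<open>Monotonicity in the horizon, started from horizon 0. Nonnegativity permits enlarging the
  factor \<open>\<tau>\<close> to \<open>2 / \<epsilon>\<close> in the second claim.\<close>

lemma noisy_regret_nat_nonneg:
  assumes "bandit_algorithm K B" "lam > 0"
  shows "0 \<le> noisy_regret_nat B n K lam"
proof -
  have "noisy_regret_nat B 0 K lam = 0"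
    using noisy_regret_eq_0[OF bandit_algorithm_pos[OF assms(1)], of 0] by (simp add: noisy_regret_def)
  then show ?thesis using noisy_regret_nat_mono[OF assms, of 0 n] by simp
qed

section \<open>Regret of the batched algorithm\<close>

lemma sum_blocks: "\<tau> > 0 \<Longrightarrow> (\<Sum>t<N * \<tau>. f t) = real \<tau> * (\<Sum>c<N. block_avg \<tau> f c)"
  unfolding block_avg_def sum.nat_group[symmetric] by (simp add: sum_divide_distrib[symmetric])

text \<open>Block-constant lists of length \<open>N * \<tau>\<close> correspond to lists of
  \<open>N\<close> block actions. Under this correspondence the loss is \<open>\<tau>\<close> times
  the sum of the averages, and the probability is the one with which \<open>B\<close> plays the
  block actions on noisy averages.\<close>

lemma expected_loss_batched:
  fixes l :: losses
  assumes B: "bandit_algorithm K B" and tau: "\<tau> > 0" and lam: "lam > 0"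
  defines "avg \<equiv> \<lambda>c i. block_avg \<tau> (\<lambda>t. l t i) c"
  shows "expected_loss (batched K B \<tau> lam) l l (N * \<tau>)
    = real \<tau> * (\<Sum>J\<in>action_lists K N. (\<Sum>c<N. avg c (J ! c)) * smoothed B lam J (\<lambda>c. avg c (J ! c)))"
proof -
  let ?S = "action_lists K (N * \<tau>)"
  let ?g = "\<lambda>J. (\<Sum>c<N. avg c (J ! c)) * smoothed B lam J (\<lambda>c. avg c (J ! c))"
  have len: "length (blocks \<tau> xs) = N" if "length xs = N * \<tau>" for xs :: "nat list"
    using that tau by (simp add: length_blocks_dvd)
  have "expected_loss (batched K B \<tau> lam) l l (N * \<tau>)
      = (\<Sum>xs\<in>?S. (\<Sum>t<N * \<tau>. l t (xs ! t)) * pmf (actions (batched K B \<tau> lam) l (N * \<tau>)) xs)"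
    unfolding expected_loss_def by (rule expectation_actions[OF bandit_algorithm_batched[OF B tau lam]])
  also have "\<dots> = (\<Sum>xs | xs \<in> ?S \<and> block_const \<tau> xs. real \<tau> * ?g (blocks \<tau> xs))"
  proof (intro sum.mono_neutral_cong_right ballI)
    fix xs assume "xs \<in> {xs. xs \<in> ?S \<and> block_const \<tau> xs}"
    then have xs: "xs \<in> ?S" "block_const \<tau> xs" "length xs = N * \<tau>" by (auto simp: action_listsD)
    have "block_avg \<tau> (\<lambda>t. l t (xs ! t)) c = avg c (blocks \<tau> xs ! c)" if "c < N" for c
      unfolding avg_def
    proof (intro block_avg_cong)
      fix t assume t: "c * \<tau> \<le> t" "t < c * \<tau> + \<tau>"
      have "t < N * \<tau>" using t block_index_less[OF tau, of c "N * \<tau>"] that tau by simp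
      then have "xs ! t = xs ! (c * \<tau>)"
        using xs div_eq_of_block[OF t] by (auto simp: block_const_def)
      then show "l t (xs ! t) = l t (blocks \<tau> xs ! c)" using that len[OF xs(3)] by (simp add: nth_blocks)
    qed
    then have "(\<Sum>t<N * \<tau>. l t (xs ! t)) = real \<tau> * (\<Sum>c<N. avg c (blocks \<tau> xs ! c))"
      unfolding sum_blocks[OF tau] by simp
    then show "(\<Sum>t<N * \<tau>. l t (xs ! t)) * pmf (actions (batched K B \<tau> lam) l (N * \<tau>)) xs
        = real \<tau> * ?g (blocks \<tau> xs)"
      using pmf_actions_batched[OF B tau lam xs(1), of l] xs(2) by (simp add: avg_def)
  qed (auto simp: pmf_actions_batched[OF B tau lam])
  also have "\<dots> = (\<Sum>J\<in>action_lists K N. real \<tau> * ?g J)"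
  \<comment> \<open>The inverse of \<open>blocks\<close> repeats each entry \<open>\<tau>\<close>
    times.\<close>
  proof (rule sum.reindex_bij_witness[where j = "blocks \<tau>" and i = "\<lambda>J. map (\<lambda>t. J ! (t div \<tau>)) [0..<N * \<tau>]"])
    fix xs assume "xs \<in> {xs. xs \<in> ?S \<and> block_const \<tau> xs}"
    then have xs: "xs \<in> ?S" "block_const \<tau> xs" "length xs = N * \<tau>" "set xs \<subseteq> {1..K}"
      by (auto simp: action_lists_def)
    show "map (\<lambda>t. blocks \<tau> xs ! (t div \<tau>)) [0..<N * \<tau>] = xs"
    proof (rule nth_equalityI)
      fix t assume "t < length (map (\<lambda>t. blocks \<tau> xs ! (t div \<tau>)) [0..<N * \<tau>])"
      then have t: "t < N * \<tau>" by simp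
      then have "t div \<tau> < N" by (rule less_mult_imp_div_less)
      then show "map (\<lambda>t. blocks \<tau> xs ! (t div \<tau>)) [0..<N * \<tau>] ! t = xs ! t"
        using t xs len[OF xs(3)] by (simp add: nth_blocks block_const_def)
    qed (simp add: xs(3))
    show "blocks \<tau> xs \<in> action_lists K N"
      using set_blocks[OF tau, of xs] xs(4) len[OF xs(3)] by (auto simp: action_lists_def)
  next
    fix J assume J: "J \<in> action_lists K N"
    let ?xs = "map (\<lambda>t. J ! (t div \<tau>)) [0..<N * \<tau>]"
    have less: "c * \<tau> < N * \<tau>" if "c < N" for c using that tau by simp
    show "blocks \<tau> ?xs = J"
    proof (rule nth_equalityI)
      fix c assume "c < length (blocks \<tau> ?xs)"
      then show "blocks \<tau> ?xs ! c = J ! c"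
        using less[of c] tau len[of ?xs] by (simp add: nth_blocks)
    qed (use len[of ?xs] J in \<open>simp add: action_listsD\<close>)
    have "?xs ! t \<in> {1..K}" if "t < N * \<tau>" for t
      using action_listsD(2)[OF J less_mult_imp_div_less[OF that]] that by simp
    then have "?xs \<in> ?S" by (auto simp: action_lists_def)
    moreover have "block_const \<tau> ?xs"
      using tau le_less_trans[OF div_times_less_eq_dividend, of _ "N * \<tau>" \<tau>] by (simp add: block_const_def)
    ultimately show "?xs \<in> {xs. xs \<in> ?S \<and> block_const \<tau> xs}" by simp
  qed simp
  finally show ?thesis by (simp add: sum_distrib_left)
qed

text \<open>The incomplete last block has fewer than \<open>\<tau>\<close> rounds of cost at most 1,
  whence the additive \<open>\<tau>\<close>. On the complete blocks both the loss of the algorithm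
  and that of a fixed action are \<open>\<tau>\<close> times their values for the averaged
  losses.\<close>

lemma regret_batched_le:
  assumes B: "bandit_algorithm K B" and tau: "\<tau> > 0" and lam: "lam > 0"
  shows "regret (batched K B \<tau> lam) T K \<le> real \<tau> * noisy_regret_nat B (T div \<tau>) K lam + real \<tau>"
  unfolding regret_def
proof (rule cSUP_least[OF loss_seqs_nonempty])
  fix l assume l: "l \<in> loss_seqs K T"
  let ?A = "batched K B \<tau> lam" and ?N = "T div \<tau>"
  note A = bandit_algorithm_batched[OF B tau lam]
  define avg where "avg = (\<lambda>c i. block_avg \<tau> (\<lambda>t. l t i) c)"
  have le: "?N * \<tau> \<le> T" by simp
  have avg: "avg \<in> loss_seqs K ?N"
    unfolding loss_seqs_def
  proof (intro CollectI allI impI ballI)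
    fix c i assume c: "c < ?N" and i: "i \<in> {1..K}"
    have lt: "0 \<le> l t i \<and> l t i \<le> 1" if "t \<in> {c * \<tau>..<c * \<tau> + \<tau>}" for t
      using l i that block_index_less[OF tau c] by (auto simp: loss_seqs_def)
    have "(\<Sum>t\<in>{c * \<tau>..<c * \<tau> + \<tau>}. l t i) \<le> (\<Sum>t\<in>{c * \<tau>..<c * \<tau> + \<tau>}. 1)"
      using lt by (intro sum_mono) blast
    moreover have "0 \<le> (\<Sum>t\<in>{c * \<tau>..<c * \<tau> + \<tau>}. l t i)"
      using lt by (intro sum_nonneg) blast
    ultimately show "0 \<le> avg c i \<and> avg c i \<le> 1"
      using tau by (simp add: avg_def block_avg_def)
  qed
  have split: "(\<Sum>t<T. l t (f t)) = (\<Sum>t<?N * \<tau>. l t (f t)) + (\<Sum>t\<in>{?N * \<tau>..<T}. l t (f t))" for f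
    using sum.atLeastLessThan_concat[of 0 "?N * \<tau>" T "\<lambda>t. l t (f t)"] le by (simp add: atLeast0LessThan)
  have rest: "(\<Sum>t\<in>{?N * \<tau>..<T}. l t (xs ! t)) \<le> real \<tau>" if xs: "xs \<in> action_lists K T" for xs
  proof -
    have "(\<Sum>t\<in>{?N * \<tau>..<T}. l t (xs ! t)) \<le> (\<Sum>t\<in>{?N * \<tau>..<T}. 1)"
      using l action_listsD(2)[OF xs] by (intro sum_mono) (simp add: loss_seqs_def)
    also have "\<dots> = real (T mod \<tau>)" by (simp add: minus_div_mult_eq_mod)
    also have "\<dots> \<le> real \<tau>" using tau by (simp add: less_imp_le)
    finally show ?thesis .
  qed
  have "expected_loss ?A l l T
      \<le> (\<Sum>xs\<in>action_lists K T. ((\<Sum>t<?N * \<tau>. l t (xs ! t)) + real \<tau>) * pmf (actions ?A l T) xs)"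
    unfolding expected_loss_def expectation_actions[OF A] split
    using rest by (intro sum_mono mult_right_mono) auto
  also have "\<dots> = measure_pmf.expectation (actions ?A l T) (\<lambda>xs. \<Sum>t<?N * \<tau>. l t (xs ! t)) + real \<tau>"
    unfolding expectation_actions[OF A] distrib_right sum.distrib sum_distrib_left[symmetric] sum_pmf_actions[OF A] by simp
  also have "\<dots> = expected_loss ?A l l (?N * \<tau>) + real \<tau>"
    unfolding expectation_actions_truncate[OF le] ..
  finally have loss: "expected_loss ?A l l T \<le> real \<tau> *
      (\<Sum>J\<in>action_lists K ?N. (\<Sum>c<?N. avg c (J ! c)) * smoothed B lam J (\<lambda>c. avg c (J ! c))) + real \<tau>"
    unfolding expected_loss_batched[OF B tau lam] avg_def .
  \<comment> \<open>Losses are nonnegative, so ignoring the incomplete block can only decrease the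
    comparator.\<close>
  have "real \<tau> * best_loss avg ?N K \<le> best_loss l T K"
    unfolding best_loss_def[of l]
  proof (rule cINF_greatest)
    fix i assume i: "i \<in> {1..K}"
    have "real \<tau> * best_loss avg ?N K \<le> real \<tau> * (\<Sum>c<?N. avg c i)"
      using i by (intro mult_left_mono best_loss_le) auto
    also have "\<dots> = (\<Sum>t<?N * \<tau>. l t i)" unfolding sum_blocks[OF tau] avg_def ..
    also have "\<dots> \<le> (\<Sum>t<T. l t i)"
      using l i le by (intro sum_mono2) (auto simp: loss_seqs_def)
    finally show "real \<tau> * best_loss avg ?N K \<le> (\<Sum>t<T. l t i)" .
  qed (use bandit_algorithm_pos[OF B] in simp)
  then show "expected_loss ?A l l T - best_loss l T K \<le> real \<tau> * noisy_regret_nat B ?N K lam + real \<tau>"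
    using loss mult_left_mono[OF noisy_regret_nat_upper[OF B lam avg], of "real \<tau>"]
    by (simp add: right_diff_distrib)
qed

theorem theorem1:
  fixes K :: nat and B :: bandit
  assumes "bandit_algorithm K B"
  shows "(\<forall>\<tau>::nat. \<forall>\<epsilon>::real. \<tau> \<ge> 1 \<and> 0 < \<epsilon> \<and> \<epsilon> \<le> 1 \<longrightarrow>
            (\<exists>A. bandit_algorithm K A \<and> differentially_private K \<epsilon> 0 A \<and>
               (\<forall>T::nat. regret A T K
                  \<le> real \<tau> * noisy_regret B (real T / real \<tau>) K (1 / (\<epsilon> * real \<tau>)) + real \<tau>)))
       \<and> (\<forall>\<epsilon>::real. 0 < \<epsilon> \<and> \<epsilon> \<le> 1 \<longrightarrow>
            (\<exists>A. bandit_algorithm K A \<and> differentially_private K \<epsilon> 0 A \<and>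
               (\<forall>T::nat. regret A T K
                  \<le> 2 / \<epsilon> * noisy_regret B (\<epsilon> * real T) K 1 + 2 / \<epsilon>)))"
proof (intro conjI allI impI; elim conjE)
  fix \<tau> :: nat and \<epsilon> :: real
  assume *: "\<tau> \<ge> 1" "0 < \<epsilon>"
  let ?lam = "1 / (\<epsilon> * real \<tau>)"
  have tau: "\<tau> > 0" and lam: "?lam > 0" using * by auto
  have "differentially_private K \<epsilon> 0 (batched K B \<tau> ?lam)"
    using * by (intro differentially_private_batched[OF assms tau lam]) simp
  moreover have "nat \<lfloor>real T / real \<tau>\<rfloor> = T div \<tau>" for T
    by (simp add: floor_divide_of_nat_eq)
  ultimately show "\<exists>A. bandit_algorithm K A \<and> differentially_private K \<epsilon> 0 A \<and>
      (\<forall>T. regret A T K \<le> real \<tau> * noisy_regret B (real T / real \<tau>) K ?lam + real \<tau>)"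
    using bandit_algorithm_batched[OF assms tau lam] regret_batched_le[OF assms tau lam]
    by (intro exI[of _ "batched K B \<tau> ?lam"]) (simp add: noisy_regret_def)
next
  fix \<epsilon> :: real
  assume eps: "0 < \<epsilon>" "\<epsilon> \<le> 1"
  \<comment> \<open>The lower bound \<open>1 / \<epsilon> \<le> \<tau>\<close> makes noise of scale
    1 private enough; the upper bound \<open>1 / \<epsilon> + 1\<close> is at most
    \<open>2 / \<epsilon>\<close> because \<open>\<epsilon> \<le> 1\<close>.\<close>
  define \<tau> where "\<tau> = nat \<lceil>1 / \<epsilon>\<rceil>"
  have ceil: "1 / \<epsilon> \<le> real \<tau>" "real \<tau> \<le> 1 / \<epsilon> + 1"
    using eps unfolding \<tau>_def by (auto simp: of_nat_nat intro: less_imp_le)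
  have "1 \<le> 1 / \<epsilon>" using eps by simp
  then have tau: "\<tau> > 0" and tau2: "real \<tau> \<le> 2 / \<epsilon>" using ceil by auto
  have tau_inv: "1 / real \<tau> \<le> \<epsilon>" using ceil(1) eps tau by (simp add: field_simps)
  have "regret (batched K B \<tau> 1) T K \<le> 2 / \<epsilon> * noisy_regret B (\<epsilon> * real T) K 1 + 2 / \<epsilon>" for T
  proof -
    have "real T / real \<tau> \<le> \<epsilon> * real T"
      using mult_right_mono[OF tau_inv, of "real T"] by simp
    then have "nat \<lfloor>real T / real \<tau>\<rfloor> \<le> nat \<lfloor>\<epsilon> * real T\<rfloor>" by (intro nat_mono floor_mono)
    then have "T div \<tau> \<le> nat \<lfloor>\<epsilon> * real T\<rfloor>" by (simp add: floor_divide_of_nat_eq)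
    then have "noisy_regret_nat B (T div \<tau>) K 1 \<le> noisy_regret B (\<epsilon> * real T) K 1"
      unfolding noisy_regret_def by (intro noisy_regret_nat_mono[OF assms]) simp_all
    moreover have "0 \<le> noisy_regret_nat B (T div \<tau>) K 1"
      by (intro noisy_regret_nat_nonneg[OF assms]) simp
    ultimately have "real \<tau> * noisy_regret_nat B (T div \<tau>) K 1 \<le> 2 / \<epsilon> * noisy_regret B (\<epsilon> * real T) K 1"
      using tau2 eps by (intro mult_mono) auto
    then show ?thesis using regret_batched_le[OF assms tau, of 1 T] tau2 by simp
  qed
  moreover have "differentially_private K \<epsilon> 0 (batched K B \<tau> 1)"
    using tau_inv by (intro differentially_private_batched[OF assms tau]) simp_all
  moreover have "bandit_algorithm K (batched K B \<tau> 1)"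
    by (intro bandit_algorithm_batched[OF assms tau]) simp
  ultimately show "\<exists>A. bandit_algorithm K A \<and> differentially_private K \<epsilon> 0 A \<and>
      (\<forall>T. regret A T K \<le> 2 / \<epsilon> * noisy_regret B (\<epsilon> * real T) K 1 + 2 / \<epsilon>)"
    by blast
qed

end
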